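(* Let $X$ and $M$ be real Banach spaces, let $\mathcal{U}_0\subset X$ be a subset and let $\mathcal{O}_0\subset M$ be an open subset. Let $J:\mathcal{U}_0\times\mathcal{O}_0\to\mathbb{R}$ be a real valued functional and $u:\mathcal{O}_0\to\mathcal{U}_0$ a map, and define $J_*(\mu):=J(u(\mu),\mu)$ for $\mu\in\mathcal{O}_0$. Suppose that: 1. $J\in C^0(\mathcal{U}_0\times\mathcal{O}_0)$, $J(w,\cdot)\in C^1(\mathcal{O}_0)$ for every $w\in\mathcal{U}_0$, and $\partial_MJ\in C^0(\mathcal{U}_0\times\mathcal{O}_0,M')$; 2. $u\in C^0(\mathcal{O}_0,X)$, and $u(\mu)$ is a global minimizer of $J(\cdot,\mu)$ in $\mathcal{U}_0$ for each $\mu\in\mathcal{O}_0$. Then $J_*\in C^1(\mathcal{O}_0)$ and $$J_*'(\mu)=\partial_MJ(u(\mu),\mu)\qquad(\mu\in\mathcal{O}_0).$$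
   Context: $M'$ is the dual space of $M$. $\partial_M J$ denotes the partial Fréchet derivative of $J(w,\mu)$ with respect to $\mu\in M$, and $J_*'$ the Fréchet derivative of $J_*$. $C^1$ means continuously Fréchet differentiable. For a real valued functional $J$ on a metric space $S$, $u_0\in S$ is a global minimizer of $J$ in $S$ if $J(u_0)\le J(u)$ for all $u\in S$. *)

theory Defs
  imports "HOL-Analysis.Analysis"
begin

(* The Frechet derivative as an element of the normed space of bounded linear maps, so that its
   continuity in x is with respect to the operator norm. The value is only meaningful where f is
   differentiable. *)
definition frechet ::
    "('a::real_normed_vector \<Rightarrow> 'b::real_normed_vector) \<Rightarrow> 'a \<Rightarrow> ('a \<Rightarrow>\<^sub>L 'b)" where
  "frechet f x = Blinfun (frechet_derivative f (at x))"

lemma frechet_eqI: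
  assumes "(f has_derivative blinfun_apply f') (at x)"
  shows "frechet f x = f'"
  unfolding frechet_def frechet_derivative_at[OF assms, symmetric]
  by (rule blinfun_apply_inverse)

(* Intended for open S, where the derivatives at points of S do not depend on values of f
   outside S. *)
definition C1_on ::
    "'a::real_normed_vector set \<Rightarrow> ('a \<Rightarrow> 'b::real_normed_vector) \<Rightarrow> bool" where
  "C1_on S f \<longleftrightarrow> (\<forall>x\<in>S. f differentiable (at x)) \<and> continuous_on S (frechet f)"

definition partial_M ::
    "('x \<times> 'm \<Rightarrow> real) \<Rightarrow> 'x \<times> 'm \<Rightarrow> ('m::real_normed_vector \<Rightarrow>\<^sub>L real)" where
  "partial_M J = (\<lambda>(w, \<mu>). frechet (\<lambda>\<nu>. J (w, \<nu>)) \<mu>)"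

definition global_minimizer_in :: "('a \<Rightarrow> real) \<Rightarrow> 'a set \<Rightarrow> 'a \<Rightarrow> bool" where
  "global_minimizer_in F S u0 \<longleftrightarrow> u0 \<in> S \<and> (\<forall>w\<in>S. F u0 \<le> F w)"

definition J_star :: "('x \<times> 'm \<Rightarrow> real) \<Rightarrow> ('m \<Rightarrow> 'x) \<Rightarrow> 'm \<Rightarrow> real" where
  "J_star J u \<mu> = J (u \<mu>, \<mu>)"

end

theory Submission
  imports Defs
begin

text \<open>
  Write \<open>p = \<partial>\<^sub>M J(u(\<mu>), \<mu>)\<close>. Minimality of \<open>u(\<mu>)\<close> and of \<open>u(\<nu>)\<close> sandwiches the increment of \<open>J\<^sub>*\<close>:
  \<open>J(u(\<nu>), \<nu>) - J(u(\<nu>), \<mu>) \<le> J\<^sub>*(\<nu>) - J\<^sub>*(\<mu>) \<le> J(u(\<mu>), \<nu>) - J(u(\<mu>), \<mu>)\<close>.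
  By the mean value inequality and the joint continuity of \<open>\<partial>\<^sub>M J\<close>, both bounds differ from
  \<open>p(\<nu> - \<mu>)\<close> by at most \<open>\<epsilon> \<parallel>\<nu> - \<mu>\<parallel>\<close> once \<open>\<nu>\<close> is close to \<open>\<mu>\<close>, since \<open>u(\<nu>)\<close> is then close to \<open>u(\<mu>)\<close>.
\<close>

text \<open>\<open>Blinfun\<close> inverts \<open>blinfun_apply\<close> only on bounded linear maps;
  differentiability guarantees that the derivative is one.\<close>

lemma frechet_has_derivative:
  assumes "f differentiable (at x)"
  shows "(f has_derivative blinfun_apply (frechet f x)) (at x)"
proof -
  have "(f has_derivative frechet_derivative f (at x)) (at x)"
    using assms by (simp add: frechet_derivative_works)
  then show ?thesis
    unfolding frechet_def
    by (simp add: bounded_linear_Blinfun_apply has_derivative_bounded_linear)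
qed

lemma partial_M_has_derivative:
  assumes "C1_on S (\<lambda>\<nu>. J (w, \<nu>))" and "\<mu> \<in> S"
  shows "((\<lambda>\<nu>. J (w, \<nu>)) has_derivative blinfun_apply (partial_M J (w, \<mu>))) (at \<mu>)"
  using assms frechet_has_derivative[of "\<lambda>\<nu>. J (w, \<nu>)" \<mu>] by (simp add: C1_on_def partial_M_def)

text \<open>Mean value inequality for \<open>g - p\<close>: its derivative \<open>g' z - p\<close>
  has operator norm at most \<open>e\<close> on the convex set.\<close>

lemma blinfun_linearization_bound:
  fixes g :: "'a::real_normed_vector \<Rightarrow> 'b::real_normed_vector" and p :: "'a \<Rightarrow>\<^sub>L 'b"
  assumes "convex S"
    and deriv: "\<And>x. x \<in> S \<Longrightarrow> (g has_derivative blinfun_apply (g' x)) (at x)"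
    and close: "\<And>x. x \<in> S \<Longrightarrow> norm (g' x - p) \<le> e"
    and "x \<in> S" "y \<in> S"
  shows "norm (g y - g x - p (y - x)) \<le> e * norm (y - x)"
proof -
  have "((\<lambda>z. g z - p z) has_derivative blinfun_apply (g' z - p)) (at z within S)" if "z \<in> S" for z
    unfolding blinfun.diff_left
    by (intro has_derivative_diff has_derivative_at_withinI[OF deriv[OF that]]
        bounded_linear_imp_has_derivative blinfun.bounded_linear_right)
  moreover have "onorm (blinfun_apply (g' z - p)) \<le> e" if "z \<in> S" for z
    using close[OF that] by (simp add: norm_blinfun.rep_eq)
  ultimately have "norm ((g y - p y) - (g x - p x)) \<le> e * norm (y - x)"
    by (rule differentiable_bound[OF \<open>convex S\<close>]) (use assms in auto)
  then show ?thesis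
    by (simp add: blinfun.diff_right algebra_simps)
qed

text \<open>The slope is frozen at \<open>(w0, \<mu>)\<close> and the radius \<open>d\<close> does
  not depend on \<open>w\<close>. This uniformity permits \<open>w = u \<nu>\<close>, a point that
  moves with \<open>\<nu>\<close>.\<close>

lemma partial_M_uniform_linearization:
  fixes J :: "'x::real_normed_vector \<times> 'm::real_normed_vector \<Rightarrow> real"
  assumes "open O0"
    and C1: "\<And>w. w \<in> U0 \<Longrightarrow> C1_on O0 (\<lambda>\<mu>. J (w, \<mu>))"
    and cont: "continuous_on (U0 \<times> O0) (partial_M J)"
    and "w0 \<in> U0" "\<mu> \<in> O0" "e > 0"
  obtains d where "d > 0" "ball \<mu> d \<subseteq> O0"
    "\<And>w \<nu>. \<lbrakk>w \<in> U0; dist w w0 < d; \<nu> \<in> ball \<mu> d\<rbrakk> \<Longrightarrow>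
      \<bar>J (w, \<nu>) - J (w, \<mu>) - partial_M J (w0, \<mu>) (\<nu> - \<mu>)\<bar> \<le> e * norm (\<nu> - \<mu>)"
proof -
  obtain r where r: "r > 0" "ball \<mu> r \<subseteq> O0"
    using \<open>open O0\<close> \<open>\<mu> \<in> O0\<close> open_contains_ball by blast
  have "(w0, \<mu>) \<in> U0 \<times> O0" using assms by simp
  then obtain s where s: "s > 0"
    "\<And>q. q \<in> U0 \<times> O0 \<Longrightarrow> dist q (w0, \<mu>) < s \<Longrightarrow>
       dist (partial_M J q) (partial_M J (w0, \<mu>)) < e"
    using cont \<open>e > 0\<close> unfolding continuous_on_iff by metis
  \<comment> \<open>The bound \<open>r\<close> keeps the ball inside \<open>O0\<close>; with
    \<open>s / 2\<close> in each coordinate, the Euclidean product distance to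
    \<open>(w0, \<mu>)\<close> stays below \<open>s\<close>.\<close>
  define d where "d = min r (s / 2)"
  have sub: "ball \<mu> d \<subseteq> O0" and "d > 0"
    using r s by (auto simp: d_def)
  have "\<bar>J (w, \<nu>) - J (w, \<mu>) - partial_M J (w0, \<mu>) (\<nu> - \<mu>)\<bar> \<le> e * norm (\<nu> - \<mu>)"
    if w: "w \<in> U0" "dist w w0 < d" and \<nu>: "\<nu> \<in> ball \<mu> d" for w \<nu>
  proof -
    have "norm (partial_M J (w, x) - partial_M J (w0, \<mu>)) \<le> e" if x: "x \<in> ball \<mu> d" for x
    proof -
      have "dist (w, x) (w0, \<mu>) < s"
        unfolding dist_Pair_Pair
        by (rule sqrt_sum_squares_half_less) (use w x in \<open>auto simp: d_def dist_commute\<close>)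
      then have "dist (partial_M J (w, x)) (partial_M J (w0, \<mu>)) < e"
        using s(2) w x sub by blast
      then show ?thesis by (simp add: dist_norm)
    qed
    moreover have "((\<lambda>\<nu>. J (w, \<nu>)) has_derivative partial_M J (w, x)) (at x)" 
      if "x \<in> ball \<mu> d" for x
      using partial_M_has_derivative[OF C1[OF w(1)]] that sub by blast
    ultimately have "norm (J (w, \<nu>) - J (w, \<mu>) - partial_M J (w0, \<mu>) (\<nu> - \<mu>)) \<le> e * norm (\<nu> - \<mu>)"
      using \<nu> \<open>d > 0\<close>
      by (intro blinfun_linearization_bound[where S = "ball \<mu> d" and g' = "\<lambda>x. partial_M J (w, x)"])
        auto
    then show ?thesis by simp
  qed
  then show ?thesis using that sub \<open>d > 0\<close> by blast
qed

lemma J_star_has_derivative: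
  fixes J :: "'x::real_normed_vector \<times> 'm::real_normed_vector \<Rightarrow> real"
  assumes "open O0"
    and C1: "\<And>w. w \<in> U0 \<Longrightarrow> C1_on O0 (\<lambda>\<mu>. J (w, \<mu>))"
    and cont: "continuous_on (U0 \<times> O0) (partial_M J)"
    and u: "continuous_on O0 u"
    and min: "\<And>\<mu>. \<mu> \<in> O0 \<Longrightarrow> global_minimizer_in (\<lambda>w. J (w, \<mu>)) U0 (u \<mu>)"
    and \<mu>: "\<mu> \<in> O0"
  shows "(J_star J u has_derivative partial_M J (u \<mu>, \<mu>)) (at \<mu>)"
  unfolding has_derivative_at_alt
proof (intro conjI allI impI)
  show "bounded_linear (partial_M J (u \<mu>, \<mu>))"
    by (rule blinfun.bounded_linear_right)
next
  fix e :: real assume "e > 0"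
  have uU: "u \<nu> \<in> U0" and le: "w \<in> U0 \<Longrightarrow> J (u \<nu>, \<nu>) \<le> J (w, \<nu>)" if "\<nu> \<in> O0" for w \<nu>
    using min[OF that] by (auto simp: global_minimizer_in_def)
  obtain d where d: "d > 0" "ball \<mu> d \<subseteq> O0"
    "\<And>w \<nu>. \<lbrakk>w \<in> U0; dist w (u \<mu>) < d; \<nu> \<in> ball \<mu> d\<rbrakk> \<Longrightarrow>
      \<bar>J (w, \<nu>) - J (w, \<mu>) - partial_M J (u \<mu>, \<mu>) (\<nu> - \<mu>)\<bar> \<le> e * norm (\<nu> - \<mu>)"
    using partial_M_uniform_linearization[OF \<open>open O0\<close> C1 cont uU[OF \<mu>] \<mu> \<open>e > 0\<close>] by blast
  \<comment> \<open>Continuity of \<open>u\<close> brings \<open>u \<nu>\<close> within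
    \<open>d\<close> of \<open>u \<mu>\<close>, so that the uniform estimate covers
    \<open>w = u \<nu>\<close>.\<close>
  obtain c where c: "c > 0" "\<And>\<nu>. \<nu> \<in> O0 \<Longrightarrow> dist \<nu> \<mu> < c \<Longrightarrow> dist (u \<nu>) (u \<mu>) < d"
    using u \<mu> d(1) unfolding continuous_on_iff by metis
  show "\<exists>d>0. \<forall>\<nu>. norm (\<nu> - \<mu>) < d \<longrightarrow>
      norm (J_star J u \<nu> - J_star J u \<mu> - partial_M J (u \<mu>, \<mu>) (\<nu> - \<mu>)) \<le> e * norm (\<nu> - \<mu>)"
  proof (intro exI[of _ "min c d"] conjI allI impI)
    show "min c d > 0" using c d by simp
  next
    fix \<nu> assume "norm (\<nu> - \<mu>) < min c d"
    then have ball: "\<nu> \<in> ball \<mu> d" and "dist \<nu> \<mu> < c"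
      by (auto simp: dist_norm norm_minus_commute)
    then have \<nu>: "\<nu> \<in> O0" and close: "dist (u \<nu>) (u \<mu>) < d"
      using c d by auto
    \<comment> \<open>The estimate with \<open>w = u \<mu>\<close> and minimality of
      \<open>u \<nu>\<close> at \<open>\<nu>\<close> bound the increment from above; the estimate
      with \<open>w = u \<nu>\<close> and minimality of \<open>u \<mu>\<close> at
      \<open>\<mu>\<close> bound it from below.\<close>
    show "norm (J_star J u \<nu> - J_star J u \<mu> - partial_M J (u \<mu>, \<mu>) (\<nu> - \<mu>)) \<le> e * norm (\<nu> - \<mu>)"
      using d(3)[OF uU[OF \<mu>] _ ball] d(3)[OF uU[OF \<nu>] close ball] d(1)
        le[OF \<mu> uU[OF \<nu>]] le[OF \<nu> uU[OF \<mu>]]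
      by (simp add: J_star_def)
  qed
qed

theorem theorem0p2p1:
  fixes U0 :: "'x::banach set"
    and O0 :: "'m::banach set"
    and J :: "'x \<times> 'm \<Rightarrow> real"
    and u :: "'m \<Rightarrow> 'x"
  assumes "open O0"
    and "u \<in> O0 \<rightarrow> U0"
    and "continuous_on (U0 \<times> O0) J"
    and "\<And>w. w \<in> U0 \<Longrightarrow> C1_on O0 (\<lambda>\<mu>. J (w, \<mu>))"
    and "continuous_on (U0 \<times> O0) (partial_M J)"
    and "continuous_on O0 u"
    and "\<And>\<mu>. \<mu> \<in> O0 \<Longrightarrow> global_minimizer_in (\<lambda>w. J (w, \<mu>)) U0 (u \<mu>)"
  shows "C1_on O0 (J_star J u) \<and>
    (\<forall>\<mu>\<in>O0. frechet (J_star J u) \<mu> = partial_M J (u \<mu>, \<mu>))"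
proof -
  have deriv: "(J_star J u has_derivative partial_M J (u \<mu>, \<mu>)) (at \<mu>)" if "\<mu> \<in> O0" for \<mu>
    using J_star_has_derivative[OF assms(1,4-7) that] .
  then have eq: "frechet (J_star J u) \<mu> = partial_M J (u \<mu>, \<mu>)" if "\<mu> \<in> O0" for \<mu>
    using frechet_eqI that by blast
  \<comment> \<open>The derivative formula is \<open>partial_M J\<close> composed with the
    continuous map from \<open>\<mu>\<close> to \<open>(u \<mu>, \<mu>)\<close>, so its continuity
    is in operator norm, as \<open>C1_on\<close> demands.\<close>
  have "continuous_on O0 (\<lambda>\<mu>. partial_M J (u \<mu>, \<mu>))"
    by (rule continuous_on_compose2[OF assms(5)])
      (use assms(2,6) in \<open>auto intro!: continuous_intros\<close>)
  then have "continuous_on O0 (frechet (J_star J u))"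
    by (simp add: eq cong: continuous_on_cong)
  then show ?thesis
    using deriv eq unfolding C1_on_def differentiable_def by blast
qed

end
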